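(* Let $n,p\ge 1$ and $1\le s\le p$ be integers, let $\Theta\subseteq\mathbb{R}^p$ be a given set, and suppose that $y=X\theta^*+\xi$ and $Z=X+\Xi$, where $\theta^*\in\Theta$ is $s$-sparse. Let $\varepsilon\ge 0$, let $b(\varepsilon)\ge0$ and $\delta_i(\varepsilon)\ge 0$, $i=1,\dots,5$, be thresholds satisfying $$\mathbb{P}\Big(\max_{1\le j\le p}|\hat\sigma_j^2-\sigma_j^2|\ge b(\varepsilon)\Big)\le\varepsilon,\qquad \mathbb{P}\big(|M^{(i)}|_\infty\ge\delta_i(\varepsilon)\big)\le\varepsilon,\quad i=1,\dots,5,$$ and put $\mu(\varepsilon)=\delta_1(\varepsilon)+\delta_4(\varepsilon)+\delta_5(\varepsilon)+b(\varepsilon)$, $\tau(\varepsilon)=\delta_2(\varepsilon)+\delta_3(\varepsilon)$, $$\mathcal{A}(\varepsilon)=\Big\{\theta\in\Theta:\ \Big|\tfrac1n Z^T(y-Z\theta)+\widehat D\theta\Big|_\infty\le\mu(\varepsilon)|\theta|_1+\tau(\varepsilon)\Big\},$$ $$\nu(\varepsilon)=2\big(\mu(\varepsilon)+\delta_1(\varepsilon)\big)|\theta^*|_1+2\tau(\varepsilon).$$ Then, with probability at least $1-6\varepsilon$, the set $\mathcal{A}(\varepsilon)$ is not empty and every solution $\hat\theta$ of the minimization problem $\min\{|\theta|_1:\ \theta\in\mathcal{A}(\varepsilon)\}$ satisfies $$|\hat\theta-\theta^*|_q\le\frac{\nu(\varepsilon)}{\kappa_q(s)}\quad\text{for all }1\le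 q\le\infty,$$ $$|\hat\theta_k-\theta^*_k|\le\frac{\nu(\varepsilon)}{\kappa_k^*(s)}\quad\text{for all }1\le k\le p,$$ $$\frac1n|X(\hat\theta-\theta^* )|_2^2\le\min\Big\{\frac{\nu^2(\varepsilon)}{\kappa_1(s)},\ 2\nu(\varepsilon)|\theta^*|_1\Big\}.$$
   Context: Model: $y\in\mathbb{R}^n$ and the $n\times p$ matrix $Z$ are observed; $X$ is an unknown $n\times p$ matrix (deterministic or random), $\Xi$ is an $n\times p$ random noise matrix, $\xi\in\mathbb{R}^n$ is a random noise vector, $\theta^*$ is an unknown deterministic parameter vector. A vector is $s$-sparse if it has only $s$ non-zero components (i.e. at most $s$). Norms: $|\cdot|_q$ is the $\ell_q$-norm of a vector, $1\le q\le\infty$; for a matrix $A$, $|A|_\infty$ is the maximum absolute value of its entries. Variances: $\sigma_j^2=\frac1n\sum_{i=1}^n\mathbb{E}(\Xi_{ij}^2)$, assumed finite, $1\le j\le p$. $D$ is the $p\times p$ diagonal matrix with diagonal entries $\sigma_j^2$. The $\hat\sigma_j^2$ are given estimators (random variables) of $\sigma_j^2$, and $\widehat D$ is the diagonal matrix with diagonal entries $\hat\sigma_j^2$. Stochastic error terms: $M^{(1)}=\frac1nX^T\Xi$, $M^{(2)}=\frac1nX^T\xi$, $M^{(3)}=\frac1n\Xi^T\xi$, $M^{(4)}=\frac1n(\Xi^T\Xi-\mathrm{Diag}\{\Xi^T\Xi\})$, $M^{(5)}=\frac1n\mathrm{Diag}\{\Xi^T\Xi\}-D$, where $\mathrm{Diag}\{A\}$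 is the diagonal matrix with the same diagonal as the square matrix $A$. Sensitivities: $\Psi=\frac1nX^TX$. For $J\subseteq\{1,\dots,p\}$, $\Delta_J$ is the vector in $\mathbb{R}^p$ that agrees with $\Delta$ on $J$ and is zero on the complement $J^c$, and $C_J=\{\Delta\in\mathbb{R}^p:\ |\Delta_{J^c}|_1\le|\Delta_J|_1\}$. For $q\in[1,\infty]$ and $k\in\{1,\dots,p\}$, $$\kappa_q(s)=\min_{J:\,|J|\le s}\ \min_{\Delta\in C_J:\,|\Delta|_q=1}|\Psi\Delta|_\infty,\qquad \kappa_k^*(s)=\min_{J:\,|J|\le s}\ \min_{\Delta\in C_J:\,\Delta_k=1}|\Psi\Delta|_\infty,$$ where $|J|$ is the cardinality of $J$ and a minimum over an empty set is $+\infty$. Convention: $1/0=\infty$, so a bound with zero sensitivity in the denominator is vacuous. *)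

theory Defs
  imports "HOL-Probability.Probability"
begin

text \<open>
  Vectors and matrices are indexed by finite types, so that \<open>n = CARD('n)\<close> and
  \<open>p = CARD('p)\<close>; an \<open>n \<times> p\<close> matrix has type \<open>real ^ 'p ^ 'n\<close>.
\<close>

text \<open>Only exponents \<open>1 \<le> q \<le> \<infinity>\<close> are meaningful.\<close>

definition lq_norm :: "ereal \<Rightarrow> real ^ 'k \<Rightarrow> real" where
  "lq_norm q x =
     (if q = \<infinity> then (MAX i. \<bar>x $ i\<bar>)
      else (\<Sum>i\<in>UNIV. \<bar>x $ i\<bar> powr real_of_ereal q) powr (1 / real_of_ereal q))"

definition mat_max_norm :: "real ^ 'k ^ 'm \<Rightarrow> real" where
  "mat_max_norm A = (MAX (i, j). \<bar>A $ i $ j\<bar>)"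

definition diag_mat :: "real ^ 'p \<Rightarrow> real ^ 'p ^ 'p" where
  "diag_mat v = (\<chi> i j. if i = j then v $ i else 0)"

definition diag_part :: "real ^ 'p ^ 'p \<Rightarrow> real ^ 'p ^ 'p" where
  "diag_part A = diag_mat (\<chi> i. A $ i $ i)"

definition sparse_vec :: "nat \<Rightarrow> real ^ 'p \<Rightarrow> bool" where
  "sparse_vec s v \<longleftrightarrow> card {j. v $ j \<noteq> 0} \<le> s"

definition noise_var :: "'w measure \<Rightarrow> ('w \<Rightarrow> real ^ 'p ^ 'n) \<Rightarrow> real ^ 'p" where
  "noise_var M \<Xi> =
     (\<chi> j. 1 / real CARD('n) * (\<Sum>i\<in>UNIV. (LINT \<omega>|M. (\<Xi> \<omega> $ i $ j)\<^sup>2)))"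

definition M1 :: "real ^ 'p ^ 'n \<Rightarrow> real ^ 'p ^ 'n \<Rightarrow> real ^ 'p ^ 'p" where
  "M1 X \<Xi> = (1 / real CARD('n)) *\<^sub>R (transpose X ** \<Xi>)"

definition M2 :: "real ^ 'p ^ 'n \<Rightarrow> real ^ 'n \<Rightarrow> real ^ 'p" where
  "M2 X \<xi> = (1 / real CARD('n)) *\<^sub>R (transpose X *v \<xi>)"

definition M3 :: "real ^ 'p ^ 'n \<Rightarrow> real ^ 'n \<Rightarrow> real ^ 'p" where
  "M3 \<Xi> \<xi> = (1 / real CARD('n)) *\<^sub>R (transpose \<Xi> *v \<xi>)"

definition M4 :: "real ^ 'p ^ 'n \<Rightarrow> real ^ 'p ^ 'p" where
  "M4 \<Xi> = (1 / real CARD('n)) *\<^sub>R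
     (transpose \<Xi> ** \<Xi> - diag_part (transpose \<Xi> ** \<Xi>))"

definition M5 :: "real ^ 'p \<Rightarrow> real ^ 'p ^ 'n \<Rightarrow> real ^ 'p ^ 'p" where
  "M5 \<sigma>2 \<Xi> = (1 / real CARD('n)) *\<^sub>R diag_part (transpose \<Xi> ** \<Xi>) - diag_mat \<sigma>2"

definition gram :: "real ^ 'p ^ 'n \<Rightarrow> real ^ 'p ^ 'p" where
  "gram X = (1 / real CARD('n)) *\<^sub>R (transpose X ** X)"

definition restrict_vec :: "'p set \<Rightarrow> real ^ 'p \<Rightarrow> real ^ 'p" where
  "restrict_vec J \<Delta> = (\<chi> j. if j \<in> J then \<Delta> $ j else 0)"

definition dom_cone :: "'p set \<Rightarrow> (real ^ 'p) set" where
  "dom_cone J = {\<Delta>. lq_norm 1 (restrict_vec (- J) \<Delta>) \<le> lq_norm 1 (restrict_vec J \<Delta>)}"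

text \<open>
  The minima defining the sensitivities are infima in \<^typ>\<open>ereal\<close>, where the infimum of the
  empty set is \<open>\<infinity>\<close>. Over nonempty constraint sets they are attained: by compactness
  for \<open>kappa\<close>, and because the objective is a maximum of finitely many absolute values of
  linear forms on a finite union of polyhedra for \<open>kappa_star\<close>.
\<close>

definition kappa :: "ereal \<Rightarrow> nat \<Rightarrow> real ^ 'p ^ 'n \<Rightarrow> ereal" where
  "kappa q s X =
     (INF J\<in>{J. card J \<le> s}. INF \<Delta>\<in>{\<Delta> \<in> dom_cone J. lq_norm q \<Delta> = 1}.
        ereal (lq_norm \<infinity> (gram X *v \<Delta>)))"

definition kappa_star :: "'p \<Rightarrow> nat \<Rightarrow> real ^ 'p ^ 'n \<Rightarrow> ereal" where
  "kappa_star k s X =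
     (INF J\<in>{J. card J \<le> s}. INF \<Delta>\<in>{\<Delta> \<in> dom_cone J. \<Delta> $ k = 1}.
        ereal (lq_norm \<infinity> (gram X *v \<Delta>)))"

text \<open>
  A bound with zero sensitivity is vacuous, even for a zero numerator, where division in
  \<^typ>\<open>ereal\<close> would give \<open>0 / 0 = 0\<close>.
\<close>

definition sens_bound :: "real \<Rightarrow> ereal \<Rightarrow> ereal" where
  "sens_bound a \<kappa> = (if \<kappa> = 0 then \<infinity> else ereal a / \<kappa>)"

definition feasible_set ::
  "(real ^ 'p) set \<Rightarrow> real ^ 'n \<Rightarrow> real ^ 'p ^ 'n \<Rightarrow> real ^ 'p \<Rightarrow> real \<Rightarrow> real \<Rightarrow> (real ^ 'p) set" where
  "feasible_set \<Theta> y Z \<sigma>2hat \<mu> \<tau> =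
     {\<theta> \<in> \<Theta>.
        lq_norm \<infinity> ((1 / real CARD('n)) *\<^sub>R (transpose Z *v (y - Z *v \<theta>)) + diag_mat \<sigma>2hat *v \<theta>)
          \<le> \<mu> * lq_norm 1 \<theta> + \<tau>}"

end

theory Submission
  imports Defs
begin

text \<open>
  On the event where all six stochastic errors stay below their thresholds, the residual of
  the corrected score at any \<open>\<theta>\<close> is, up to at most \<open>\<mu> |\<theta>|\<^sub>1 + \<tau>\<close>, the vector
  \<open>- \<Psi> \<Delta> - M\<^sup>(\<^sup>1\<^sup>)\<^sup>T \<Delta>\<close> with \<open>\<Delta> = \<theta> - \<theta>\<^sup>*\<close>. Hence \<open>\<theta>\<^sup>*\<close> is feasible, a minimizer has
  \<open>|\<theta>|\<^sub>1 \<le> |\<theta>\<^sup>*|\<^sub>1\<close> (so \<open>\<Delta>\<close> lies in the cone of the support of \<open>\<theta>\<^sup>*\<close> and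
  \<open>|\<Delta>|\<^sub>1 \<le> 2 |\<theta>\<^sup>*|\<^sub>1\<close>), and feasibility of the minimizer gives \<open>|\<Psi> \<Delta>|\<^sub>\<infinity> \<le> \<nu>\<close>. Homogeneity turns
  this into the sensitivity bounds, and duality of the \<open>\<ell>\<^sub>1\<close> and \<open>\<ell>\<^sub>\<infinity>\<close> norms into the prediction bound.
\<close>

section \<open>Norms\<close>

lemma lq_norm_1: "lq_norm 1 x = (\<Sum>i\<in>UNIV. \<bar>x $ i\<bar>)"
  by (simp add: lq_norm_def sum_nonneg)

lemma lq_norm_2_squared: "(lq_norm 2 x)\<^sup>2 = x \<bullet> x"
proof -
  have "(lq_norm 2 x)\<^sup>2 = ((\<Sum>i\<in>UNIV. (x $ i)\<^sup>2) powr (1/2))\<^sup>2"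
    by (simp add: lq_norm_def)
  also have "\<dots> = (\<Sum>i\<in>UNIV. (x $ i)\<^sup>2)"
    by (simp add: powr_half_sqrt sum_nonneg)
  finally show ?thesis
    by (simp add: inner_vec_def power2_eq_square)
qed

lemma lq_norm_inf_le_iff: "lq_norm \<infinity> x \<le> c \<longleftrightarrow> (\<forall>i. \<bar>x $ i\<bar> \<le> c)"
  by (simp add: lq_norm_def)

lemma le_lq_norm_inf_iff: "c \<le> lq_norm \<infinity> x \<longleftrightarrow> (\<exists>i. c \<le> \<bar>x $ i\<bar>)"
  by (simp add: lq_norm_def Max_ge_iff)

lemma le_mat_max_norm_iff: "c \<le> mat_max_norm A \<longleftrightarrow> (\<exists>i j. c \<le> \<bar>A $ i $ j\<bar>)"
  by (simp add: mat_max_norm_def Max_ge_iff)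

lemma lq_norm_nonneg: "0 \<le> lq_norm q x"
proof (cases "q = \<infinity>")
  case True
  then show ?thesis using le_lq_norm_inf_iff[of 0 x] by simp
qed (simp add: lq_norm_def)

lemma lq_norm_scaleR:
  assumes "1 \<le> q"
  shows "lq_norm q (c *\<^sub>R x) = \<bar>c\<bar> * lq_norm q x"
proof (cases "q = \<infinity>")
  case True
  \<comment> \<open>Multiplication by a nonnegative constant is monotone, hence commutes with a
    finite maximum.\<close>
  have "(MAX i. \<bar>c\<bar> * \<bar>x $ i\<bar>) = \<bar>c\<bar> * (MAX i. \<bar>x $ i\<bar>)"
    using mono_Max_commute[of "(*) \<bar>c\<bar>" "range (\<lambda>i. \<bar>x $ i\<bar>)"]
    by (simp add: image_image mono_def mult_left_mono)
  then show ?thesis using True by (simp add: lq_norm_def abs_mult)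
next
  case False
  with assms obtain r where r: "q = ereal r" "1 \<le> r"
    by (cases q) auto
  then have "lq_norm q (c *\<^sub>R x) = (\<bar>c\<bar> powr r * (\<Sum>i\<in>UNIV. \<bar>x $ i\<bar> powr r)) powr (1 / r)"
    by (simp add: lq_norm_def abs_mult powr_mult sum_distrib_left)
  also have "\<dots> = \<bar>c\<bar> * lq_norm q x"
    using r by (simp add: lq_norm_def powr_mult sum_nonneg powr_powr)
  finally show ?thesis .
qed

text \<open>Hoelder's inequality for the dual pair of exponents 1 and \<infinity>, applied later to
  \<Delta> and \<open>gram X *v \<Delta>\<close> for the prediction bound.\<close>

lemma inner_le_lq_norm: "x \<bullet> y \<le> lq_norm 1 x * lq_norm \<infinity> y"
proof -
  have "\<bar>y $ i\<bar> \<le> lq_norm \<infinity> y" for i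
    using lq_norm_inf_le_iff[of y "lq_norm \<infinity> y"] by simp
  moreover have "x $ i * y $ i \<le> \<bar>x $ i\<bar> * \<bar>y $ i\<bar>" for i
    by (metis abs_ge_self abs_mult)
  ultimately have "x $ i * y $ i \<le> \<bar>x $ i\<bar> * lq_norm \<infinity> y" for i
    by (meson abs_ge_zero mult_left_mono order_trans)
  then show ?thesis
    by (simp add: lq_norm_1 inner_vec_def sum_distrib_right sum_mono)
qed

text \<open>Turns entrywise control of the error matrices into errors proportional to the l1-norm of
  the vector, which is why \<mu> multiplies that norm in the feasibility constraint.\<close>

lemma abs_matrix_vector_mult_le:
  assumes "\<And>j. \<bar>A $ i $ j\<bar> \<le> c"
  shows "\<bar>(A *v x) $ i\<bar> \<le> c * lq_norm 1 x"
proof -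
  have "\<bar>(A *v x) $ i\<bar> \<le> (\<Sum>j\<in>UNIV. \<bar>A $ i $ j * x $ j\<bar>)"
    by (simp add: matrix_vector_mult_def)
  also have "\<dots> \<le> (\<Sum>j\<in>UNIV. c * \<bar>x $ j\<bar>)"
    using assms by (intro sum_mono) (simp add: abs_mult mult_right_mono)
  finally show ?thesis
    by (simp add: lq_norm_1 sum_distrib_left)
qed

section \<open>Sensitivities\<close>

text \<open>Negative factors are included: normalizing by a coordinate, as \<open>kappa_star\<close>
  does, may flip the sign.\<close>

lemma dom_cone_scaleR:
  assumes "\<Delta> \<in> dom_cone J"
  shows "c *\<^sub>R \<Delta> \<in> dom_cone J"
proof -
  have "restrict_vec K (c *\<^sub>R \<Delta>) = c *\<^sub>R restrict_vec K \<Delta>" for K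
    by (simp add: restrict_vec_def vec_eq_iff)
  then show ?thesis
    using assms by (simp add: dom_cone_def lq_norm_scaleR mult_left_mono)
qed

lemma kappa_nonneg: "0 \<le> kappa q s X"
  unfolding kappa_def by (intro INF_greatest) (simp add: lq_norm_nonneg)

text \<open>Serves both sensitivities: N is \<open>lq_norm q\<close> for \<open>kappa\<close> and
  the k-th coordinate for \<open>kappa_star\<close>, so N may be negative and only its normalization
  on \<Delta> is assumed. The rescaled vector \<Delta> / N \<Delta> competes in the infimum, which
  bounds K by \<nu> / \<bar>N \<Delta>\<bar>; solving for \<bar>N \<Delta>\<bar> gives the
  claim.\<close>

lemma abs_le_sens_bound:
  fixes N :: "real ^ 'p \<Rightarrow> real"
  assumes K: "K = (INF J\<in>{J. card J \<le> s}. INF \<Delta>\<in>{\<Delta> \<in> dom_cone J. N \<Delta> = 1}.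
        ereal (lq_norm \<infinity> (gram X *v \<Delta>)))"
    and N: "N \<Delta> \<noteq> 0 \<Longrightarrow> N ((1 / N \<Delta>) *\<^sub>R \<Delta>) = 1"
    and J: "card J \<le> s" "\<Delta> \<in> dom_cone J"
    and \<nu>: "lq_norm \<infinity> (gram X *v \<Delta>) \<le> \<nu>"
  shows "ereal \<bar>N \<Delta>\<bar> \<le> sens_bound \<nu> K"
proof -
  have K0: "0 \<le> K"
    unfolding K by (intro INF_greatest) (simp add: lq_norm_nonneg)
  have \<nu>0: "0 \<le> \<nu>"
    using \<nu> lq_norm_nonneg order_trans by blast
  show ?thesis
  proof (cases "N \<Delta> = 0")
    \<comment> \<open>Here \<Delta> cannot be normalized, but the left side is 0 and the right side
      is nonnegative, also for K = 0 and K = \<infinity>.\<close>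
    case True
    then show ?thesis
      using K0 \<nu>0 by (cases K) (auto simp: sens_bound_def)
  next
    case False
    have "K \<le> ereal (lq_norm \<infinity> (gram X *v ((1 / N \<Delta>) *\<^sub>R \<Delta>)))"
      unfolding K by (rule INF_lower2[of J], use J in simp, rule INF_lower)
        (use J N False dom_cone_scaleR in auto)
    also have "\<dots> = ereal (lq_norm \<infinity> (gram X *v \<Delta>) / \<bar>N \<Delta>\<bar>)"
      by (simp add: matrix_vector_mult_scaleR lq_norm_scaleR)
    also have "\<dots> \<le> ereal (\<nu> / \<bar>N \<Delta>\<bar>)"
      using \<nu> by (simp add: divide_right_mono)
    finally have "K \<le> ereal (\<nu> / \<bar>N \<Delta>\<bar>)" .
    \<comment> \<open>The finite upper bound rules out K = \<infinity>, and K = 0 makes the claim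
      vacuous; a positive real K allows the rearrangement.\<close>
    then show ?thesis
      using K0 False by (cases K) (auto simp: sens_bound_def field_simps)
  qed
qed

text \<open>Used with a the l1-error and v the prediction error: inserting a \<le> \<nu> / \<kappa>
  into v \<le> a * \<nu> produces the squared numerator.\<close>

lemma sens_bound_square:
  assumes "0 \<le> \<kappa>" "ereal a \<le> sens_bound \<nu> \<kappa>" "v \<le> a * \<nu>" "0 \<le> \<nu>"
  shows "ereal v \<le> sens_bound (\<nu>\<^sup>2) \<kappa>"
proof (cases \<kappa>)
  case (real k)
  show ?thesis
  proof (cases "k = 0")
    case False
    then have "a \<le> \<nu> / k"
      using assms(2) real by (simp add: sens_bound_def zero_ereal_def)
    then have "a * \<nu> \<le> \<nu> / k * \<nu>"
      using assms(4) by (rule mult_right_mono)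
    then show ?thesis
      using assms(3) real False by (simp add: sens_bound_def power2_eq_square zero_ereal_def)
  qed (use real in \<open>simp add: sens_bound_def zero_ereal_def\<close>)
next
  \<comment> \<open>A finite number divided by \<infinity> is 0, so a \<le> 0, and this forces v
    \<le> 0 as well.\<close>
  case PInf
  then have "a \<le> 0" using assms(2) by (simp add: sens_bound_def)
  then have "v \<le> 0"
    using assms(3,4) mult_nonpos_nonneg order_trans by blast
  then show ?thesis using PInf by (simp add: sens_bound_def)
qed (use assms in auto)

section \<open>The deterministic bound\<close>

text \<open>Off the support J of \<theta> the difference equals \<theta>'. Its l1-mass there is at
  most the mass of \<theta> minus that of \<theta>' on J, and the triangle inequality on J bounds
  this by the mass of the difference on J.\<close>

lemma minimizer_diff_in_dom_cone:
  assumes "lq_norm 1 \<theta>' \<le> lq_norm 1 \<theta>"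
  shows "\<theta>' - \<theta> \<in> dom_cone {j. \<theta> $ j \<noteq> 0}"
proof -
  let ?J = "{j. \<theta> $ j \<noteq> 0}"
  have restrict: "lq_norm 1 (restrict_vec K v) = (\<Sum>j\<in>K. \<bar>v $ j\<bar>)" for K and v :: "real ^ 'a"
    by (simp add: lq_norm_1 restrict_vec_def if_distrib sum.If_cases)
  have split: "lq_norm 1 v = (\<Sum>j\<in>?J. \<bar>v $ j\<bar>) + (\<Sum>j\<in>-?J. \<bar>v $ j\<bar>)" for v
    unfolding lq_norm_1 by (subst sum.union_disjoint[symmetric]) (auto simp: Un_commute)
  have "(\<Sum>j\<in>?J. \<bar>\<theta> $ j\<bar>) \<le> (\<Sum>j\<in>?J. \<bar>\<theta>' $ j\<bar> + \<bar>(\<theta>' - \<theta>) $ j\<bar>)"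
    by (intro sum_mono) auto
  moreover have "(\<Sum>j\<in>-?J. \<bar>\<theta> $ j\<bar>) = 0" "(\<Sum>j\<in>-?J. \<bar>\<theta>' $ j\<bar>) = (\<Sum>j\<in>-?J. \<bar>(\<theta>' - \<theta>) $ j\<bar>)"
    by auto
  ultimately show ?thesis
    using assms split[of \<theta>] split[of \<theta>']
    by (simp add: dom_cone_def restrict sum.distrib)
qed

text \<open>Put \<Delta> = \<theta> - \<theta>star, so that y - Z \<theta> = \<xi> - X \<Delta> -
  \<Xi> \<theta>, and multiply by the transpose of X + \<Xi>. The noise Gram matrix over n is
  \<open>M4 \<Xi> + M5 \<sigma>2 \<Xi> + diag_mat \<sigma>2\<close>; its last summand merges with
  the correction \<open>diag_mat \<sigma>2hat\<close>, leaving only the variance estimation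
  error.\<close>

lemma score_decomposition:
  fixes X \<Xi> :: "real ^ 'p ^ 'n"
  assumes y: "y = X *v \<theta>star + \<xi>" and Z: "Z = X + \<Xi>"
  shows "(1 / real CARD('n)) *\<^sub>R (transpose Z *v (y - Z *v \<theta>)) + diag_mat \<sigma>2hat *v \<theta> =
    M2 X \<xi> + M3 \<Xi> \<xi> - M1 X \<Xi> *v \<theta> - M4 \<Xi> *v \<theta> - M5 \<sigma>2 \<Xi> *v \<theta>
      + diag_mat (\<sigma>2hat - \<sigma>2) *v \<theta>
      - gram X *v (\<theta> - \<theta>star) - transpose (M1 X \<Xi>) *v (\<theta> - \<theta>star)"
proof -
  define c where "c = 1 / real CARD('n)"
  have transpose: "transpose (X + \<Xi>) = transpose X + transpose \<Xi>"
    "transpose (c *\<^sub>R A) = c *\<^sub>R transpose A" for A :: "real ^ 'p ^ 'p"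
    by (simp_all add: transpose_def vec_eq_iff)
  have diag: "diag_mat (\<sigma>2hat - \<sigma>2) = diag_mat \<sigma>2hat - diag_mat \<sigma>2"
    by (simp add: diag_mat_def vec_eq_iff)
  show ?thesis
    unfolding y Z M1_def M2_def M3_def M4_def M5_def gram_def diag c_def[symmetric] transpose
      matrix_transpose_mul transpose_transpose
      matrix_vector_mult_add_rdistrib matrix_vector_mult_diff_rdistrib
      scaleR_matrix_vector_assoc[symmetric] matrix_vector_mul_assoc[symmetric]
      matrix_vector_right_distrib matrix_vector_mult_diff_distrib
      scaleR_add_right scaleR_diff_right
    by simp
qed

lemma estimation_bounds:
  fixes X \<Xi> :: "real ^ 'p ^ 'n"
  assumes y: "y = X *v \<theta>star + \<xi>" and Z: "Z = X + \<Xi>"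
    and \<theta>star: "\<theta>star \<in> \<Theta>" "sparse_vec s \<theta>star"
    and b: "\<And>j. \<bar>\<sigma>2hat $ j - \<sigma>2 $ j\<bar> \<le> b"
    and \<delta>1: "\<And>i j. \<bar>M1 X \<Xi> $ i $ j\<bar> \<le> \<delta>1"
    and \<delta>2: "\<And>j. \<bar>M2 X \<xi> $ j\<bar> \<le> \<delta>2"
    and \<delta>3: "\<And>j. \<bar>M3 \<Xi> \<xi> $ j\<bar> \<le> \<delta>3"
    and \<delta>4: "\<And>i j. \<bar>M4 \<Xi> $ i $ j\<bar> \<le> \<delta>4"
    and \<delta>5: "\<And>i j. \<bar>M5 \<sigma>2 \<Xi> $ i $ j\<bar> \<le> \<delta>5"
    and \<mu>: "\<mu> = \<delta>1 + \<delta>4 + \<delta>5 + b"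
    and \<tau>: "\<tau> = \<delta>2 + \<delta>3"
    and \<nu>: "\<nu> = 2 * (\<mu> + \<delta>1) * lq_norm 1 \<theta>star + 2 * \<tau>"
  shows "\<theta>star \<in> feasible_set \<Theta> y Z \<sigma>2hat \<mu> \<tau>"
    and "is_arg_min (lq_norm 1) (\<lambda>\<theta>. \<theta> \<in> feasible_set \<Theta> y Z \<sigma>2hat \<mu> \<tau>) \<theta>hat \<Longrightarrow>
      (\<forall>q\<ge>1. ereal (lq_norm q (\<theta>hat - \<theta>star)) \<le> sens_bound \<nu> (kappa q s X)) \<and>
      (\<forall>k. ereal \<bar>\<theta>hat $ k - \<theta>star $ k\<bar> \<le> sens_bound \<nu> (kappa_star k s X)) \<and>
      ereal (1 / real CARD('n) * (lq_norm 2 (X *v (\<theta>hat - \<theta>star)))\<^sup>2)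
        \<le> min (sens_bound (\<nu>\<^sup>2) (kappa 1 s X)) (ereal (2 * \<nu> * lq_norm 1 \<theta>star))"
proof -
  define score where
    "score \<theta> = (1 / real CARD('n)) *\<^sub>R (transpose Z *v (y - Z *v \<theta>)) + diag_mat \<sigma>2hat *v \<theta>" for \<theta>
  \<comment> \<open>The purely stochastic part of the score, with both terms linear in \<theta> -
    \<theta>star removed; it coincides with the score at \<theta>star.\<close>
  define rest where "rest \<theta> = score \<theta> + gram X *v (\<theta> - \<theta>star)
    + transpose (M1 X \<Xi>) *v (\<theta> - \<theta>star)" for \<theta>
  have feasible_iff: "\<theta> \<in> feasible_set \<Theta> y Z \<sigma>2hat \<mu> \<tau> \<longleftrightarrow>
      \<theta> \<in> \<Theta> \<and> (\<forall>i. \<bar>score \<theta> $ i\<bar> \<le> \<mu> * lq_norm 1 \<theta> + \<tau>)" for \<theta>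
    unfolding feasible_set_def score_def lq_norm_inf_le_iff by blast
  have b0: "0 \<le> b" and \<delta>10: "0 \<le> \<delta>1" and \<mu>0: "0 \<le> \<mu>"
  proof -
    show "0 \<le> b" using b abs_ge_zero order_trans by blast
    moreover show "0 \<le> \<delta>1" using \<delta>1 abs_ge_zero order_trans by blast
    moreover have "0 \<le> \<delta>4" using \<delta>4 abs_ge_zero order_trans by blast
    moreover have "0 \<le> \<delta>5" using \<delta>5 abs_ge_zero order_trans by blast
    ultimately show "0 \<le> \<mu>" by (simp add: \<mu>)
  qed
  have diag: "\<bar>diag_mat (\<sigma>2hat - \<sigma>2) $ i $ j\<bar> \<le> b" for i j
    using b b0 by (simp add: diag_mat_def)
  have rest: "\<bar>rest \<theta> $ i\<bar> \<le> \<mu> * lq_norm 1 \<theta> + \<tau>" for \<theta> i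
  proof -
    have "rest \<theta> $ i = M2 X \<xi> $ i + M3 \<Xi> \<xi> $ i - (M1 X \<Xi> *v \<theta>) $ i - (M4 \<Xi> *v \<theta>) $ i
        - (M5 \<sigma>2 \<Xi> *v \<theta>) $ i + (diag_mat (\<sigma>2hat - \<sigma>2) *v \<theta>) $ i"
      unfolding rest_def score_def score_decomposition[OF y Z, of \<theta> \<sigma>2hat \<sigma>2] by simp
    then have "\<bar>rest \<theta> $ i\<bar> \<le> \<bar>M2 X \<xi> $ i\<bar> + \<bar>M3 \<Xi> \<xi> $ i\<bar> + \<bar>(M1 X \<Xi> *v \<theta>) $ i\<bar>
        + \<bar>(M4 \<Xi> *v \<theta>) $ i\<bar> + \<bar>(M5 \<sigma>2 \<Xi> *v \<theta>) $ i\<bar> + \<bar>(diag_mat (\<sigma>2hat - \<sigma>2) *v \<theta>) $ i\<bar>"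
      by linarith
    also have "\<dots> \<le> \<delta>2 + \<delta>3 + \<delta>1 * lq_norm 1 \<theta> + \<delta>4 * lq_norm 1 \<theta> + \<delta>5 * lq_norm 1 \<theta>
        + b * lq_norm 1 \<theta>"
      by (intro add_mono \<delta>2 \<delta>3 abs_matrix_vector_mult_le \<delta>1 \<delta>4 \<delta>5 diag)
    finally show ?thesis by (simp add: \<mu> \<tau> algebra_simps)
  qed
  have "score \<theta>star = rest \<theta>star"
    by (simp add: rest_def)
  then show feasible: "\<theta>star \<in> feasible_set \<Theta> y Z \<sigma>2hat \<mu> \<tau>"
    using \<theta>star rest by (simp add: feasible_iff)

  assume min: "is_arg_min (lq_norm 1) (\<lambda>\<theta>. \<theta> \<in> feasible_set \<Theta> y Z \<sigma>2hat \<mu> \<tau>) \<theta>hat"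
  let ?\<Delta> = "\<theta>hat - \<theta>star" and ?J = "{j. \<theta>star $ j \<noteq> 0}"
  \<comment> \<open>Feasibility of \<theta>star makes it a competitor in the minimization.\<close>
  have le: "lq_norm 1 \<theta>hat \<le> lq_norm 1 \<theta>star"
    using min feasible by (auto simp: is_arg_min_linorder)
  have "lq_norm 1 ?\<Delta> \<le> lq_norm 1 \<theta>hat + lq_norm 1 \<theta>star"
    unfolding lq_norm_1 sum.distrib[symmetric] by (intro sum_mono) auto
  with le have \<Delta>: "lq_norm 1 ?\<Delta> \<le> 2 * lq_norm 1 \<theta>star"
    by simp
  have \<mu>le: "\<mu> * lq_norm 1 \<theta>hat \<le> \<mu> * lq_norm 1 \<theta>star"
    using le \<mu>0 by (rule mult_left_mono)
  have gram: "lq_norm \<infinity> (gram X *v ?\<Delta>) \<le> \<nu>"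
    unfolding lq_norm_inf_le_iff
  proof
    fix i
    have "\<bar>score \<theta>hat $ i\<bar> \<le> \<mu> * lq_norm 1 \<theta>hat + \<tau>"
      using min by (simp add: is_arg_min_def feasible_iff)
    moreover have "\<bar>(transpose (M1 X \<Xi>) *v ?\<Delta>) $ i\<bar> \<le> \<delta>1 * lq_norm 1 ?\<Delta>"
      by (rule abs_matrix_vector_mult_le) (simp add: transpose_def \<delta>1)
    moreover have "\<delta>1 * lq_norm 1 ?\<Delta> \<le> \<delta>1 * (2 * lq_norm 1 \<theta>star)"
      using \<Delta> \<delta>10 by (rule mult_left_mono)
    moreover have "(gram X *v ?\<Delta>) $ i
        = rest \<theta>hat $ i - score \<theta>hat $ i - (transpose (M1 X \<Xi>) *v ?\<Delta>) $ i"
      by (simp add: rest_def)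
    \<comment> \<open>The three summands of \<nu>: \<open>rest\<close> and the score at \<theta>hat
      are each at most \<mu> times the l1-norm of \<theta>hat plus \<tau>, hence the factors 2 on
      \<mu> and \<tau>; the transposed \<open>M1\<close> term contributes \<delta>1 times the
      l1-norm of the difference, itself at most twice that of \<theta>star.\<close>
    moreover have "\<nu> = 2 * (\<mu> * lq_norm 1 \<theta>star) + \<delta>1 * (2 * lq_norm 1 \<theta>star) + 2 * \<tau>"
      by (simp add: \<nu> algebra_simps)
    ultimately show "\<bar>(gram X *v ?\<Delta>) $ i\<bar> \<le> \<nu>"
      using rest[of \<theta>hat i] \<mu>le by linarith
  qed
  then have \<nu>0: "0 \<le> \<nu>"
    using lq_norm_nonneg order_trans by blast
  have J: "card ?J \<le> s" "?\<Delta> \<in> dom_cone ?J"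
    using \<theta>star minimizer_diff_in_dom_cone[OF le] by (simp_all add: sparse_vec_def)
  have q: "ereal (lq_norm q ?\<Delta>) \<le> sens_bound \<nu> (kappa q s X)" if "1 \<le> q" for q
    using abs_le_sens_bound[OF kappa_def _ J gram] that
    by (simp add: lq_norm_scaleR lq_norm_nonneg)
  have k: "ereal \<bar>\<theta>hat $ k - \<theta>star $ k\<bar> \<le> sens_bound \<nu> (kappa_star k s X)" for k
    using abs_le_sens_bound[OF kappa_star_def _ J gram] by simp
  \<comment> \<open>The prediction error is the quadratic form of the Gram matrix, so l1 and
    l\<infinity> duality applies to it.\<close>
  have "1 / real CARD('n) * (lq_norm 2 (X *v ?\<Delta>))\<^sup>2 = ?\<Delta> \<bullet> (gram X *v ?\<Delta>)"
    unfolding gram_def lq_norm_2_squared scaleR_matrix_vector_assoc[symmetric]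
      matrix_vector_mul_assoc[symmetric] inner_scaleR_right dot_lmul_matrix[symmetric]
      vector_transpose_matrix ..
  also have "\<dots> \<le> lq_norm 1 ?\<Delta> * \<nu>"
    using inner_le_lq_norm gram lq_norm_nonneg by (meson mult_left_mono order_trans)
  finally have pred: "1 / real CARD('n) * (lq_norm 2 (X *v ?\<Delta>))\<^sup>2 \<le> lq_norm 1 ?\<Delta> * \<nu>" .
  have "lq_norm 1 ?\<Delta> * \<nu> \<le> 2 * lq_norm 1 \<theta>star * \<nu>"
    using \<Delta> \<nu>0 by (rule mult_right_mono)
  with pred sens_bound_square[OF kappa_nonneg q[of 1] pred \<nu>0] q k
  show "(\<forall>q\<ge>1. ereal (lq_norm q ?\<Delta>) \<le> sens_bound \<nu> (kappa q s X)) \<and>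
      (\<forall>k. ereal \<bar>\<theta>hat $ k - \<theta>star $ k\<bar> \<le> sens_bound \<nu> (kappa_star k s X)) \<and>
      ereal (1 / real CARD('n) * (lq_norm 2 (X *v ?\<Delta>))\<^sup>2)
        \<le> min (sens_bound (\<nu>\<^sup>2) (kappa 1 s X)) (ereal (2 * \<nu> * lq_norm 1 \<theta>star))"
    by (simp add: mult_ac)
qed

section \<open>Measurability and the union bound\<close>

lemma borel_measurable_vec_nth:
  fixes f :: "'w \<Rightarrow> ('a::topological_space) ^ 'k"
  assumes "f \<in> borel_measurable M"
  shows "(\<lambda>\<omega>. f \<omega> $ i) \<in> borel_measurable M"
  using assms by (rule measurable_compose)
    (intro borel_measurable_continuous_onI continuous_intros)

lemma borel_measurable_lq_norm_inf:
  assumes "\<And>i. (\<lambda>\<omega>. f \<omega> $ i) \<in> borel_measurable M"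
  shows "(\<lambda>\<omega>. lq_norm \<infinity> (f \<omega>)) \<in> borel_measurable M"
  using assms by (simp add: lq_norm_def borel_measurable_Max)

lemma borel_measurable_mat_max_norm:
  assumes "\<And>i j. (\<lambda>\<omega>. f \<omega> $ i $ j) \<in> borel_measurable M"
  shows "(\<lambda>\<omega>. mat_max_norm (f \<omega>)) \<in> borel_measurable M"
  unfolding mat_max_norm_def case_prod_beta
  using assms by (intro borel_measurable_Max) simp_all

text \<open>The union bound, passed to the complement; six bad events will cost 6
  \<epsilon>.\<close>

lemma (in prob_space) prob_compl_Union_ge:
  assumes "finite I" "\<And>i. i \<in> I \<Longrightarrow> A i \<in> events" "\<And>i. i \<in> I \<Longrightarrow> prob (A i) \<le> \<epsilon>"
  shows "1 - real (card I) * \<epsilon> \<le> prob (space M - (\<Union>i\<in>I. A i))"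
proof -
  have "prob (\<Union>i\<in>I. A i) \<le> (\<Sum>i\<in>I. prob (A i))"
    using assms by (intro finite_measure_subadditive_finite) auto
  also have "\<dots> \<le> real (card I) * \<epsilon>"
    using assms(3) by (rule sum_bounded_above)
  finally show ?thesis
    using assms by (subst prob_compl) auto
qed

theorem theorem1:
  fixes M :: "'w measure"
    and X Z \<Xi> :: "'w \<Rightarrow> real ^ 'p ^ 'n"
    and y \<xi> :: "'w \<Rightarrow> real ^ 'n"
    and \<sigma>2hat :: "'w \<Rightarrow> real ^ 'p"
    and \<Theta> :: "(real ^ 'p) set"
    and \<theta>star :: "real ^ 'p"
    and s :: nat
    and \<epsilon> b \<delta>1 \<delta>2 \<delta>3 \<delta>4 \<delta>5 \<mu> \<tau> \<nu> :: real
  assumes "prob_space M"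
    and "X \<in> borel_measurable M" "\<Xi> \<in> borel_measurable M"
    and "\<xi> \<in> borel_measurable M" "\<sigma>2hat \<in> borel_measurable M"
    and "\<And>\<omega>. \<omega> \<in> space M \<Longrightarrow> y \<omega> = X \<omega> *v \<theta>star + \<xi> \<omega>"
    and "\<And>\<omega>. \<omega> \<in> space M \<Longrightarrow> Z \<omega> = X \<omega> + \<Xi> \<omega>"
    and "\<And>i j. integrable M (\<lambda>\<omega>. (\<Xi> \<omega> $ i $ j)\<^sup>2)"
    and "1 \<le> s" "s \<le> CARD('p)"
    and "\<theta>star \<in> \<Theta>" "sparse_vec s \<theta>star"
    and "0 \<le> \<epsilon>" "0 \<le> b" "0 \<le> \<delta>1" "0 \<le> \<delta>2" "0 \<le> \<delta>3" "0 \<le> \<delta>4" "0 \<le> \<delta>5"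
    and "\<P>(\<omega> in M. (MAX j. \<bar>\<sigma>2hat \<omega> $ j - noise_var M \<Xi> $ j\<bar>) \<ge> b) \<le> \<epsilon>"
    and "\<P>(\<omega> in M. mat_max_norm (M1 (X \<omega>) (\<Xi> \<omega>)) \<ge> \<delta>1) \<le> \<epsilon>"
    and "\<P>(\<omega> in M. lq_norm \<infinity> (M2 (X \<omega>) (\<xi> \<omega>)) \<ge> \<delta>2) \<le> \<epsilon>"
    and "\<P>(\<omega> in M. lq_norm \<infinity> (M3 (\<Xi> \<omega>) (\<xi> \<omega>)) \<ge> \<delta>3) \<le> \<epsilon>"
    and "\<P>(\<omega> in M. mat_max_norm (M4 (\<Xi> \<omega>)) \<ge> \<delta>4) \<le> \<epsilon>"
    and "\<P>(\<omega> in M. mat_max_norm (M5 (noise_var M \<Xi>) (\<Xi> \<omega>)) \<ge> \<delta>5) \<le> \<epsilon>"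
    and "\<mu> = \<delta>1 + \<delta>4 + \<delta>5 + b"
    and "\<tau> = \<delta>2 + \<delta>3"
    and "\<nu> = 2 * (\<mu> + \<delta>1) * lq_norm 1 \<theta>star + 2 * \<tau>"
  shows "\<exists>E \<in> sets M. measure M E \<ge> 1 - 6 * \<epsilon> \<and>
    (\<forall>\<omega>\<in>E.
       feasible_set \<Theta> (y \<omega>) (Z \<omega>) (\<sigma>2hat \<omega>) \<mu> \<tau> \<noteq> {} \<and>
       (\<forall>\<theta>hat.
          is_arg_min (lq_norm 1)
            (\<lambda>\<theta>. \<theta> \<in> feasible_set \<Theta> (y \<omega>) (Z \<omega>) (\<sigma>2hat \<omega>) \<mu> \<tau>) \<theta>hat \<longrightarrow>
          (\<forall>q\<ge>1. ereal (lq_norm q (\<theta>hat - \<theta>star)) \<le> sens_bound \<nu> (kappa q s (X \<omega>))) \<and>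
          (\<forall>k. ereal \<bar>\<theta>hat $ k - \<theta>star $ k\<bar> \<le> sens_bound \<nu> (kappa_star k s (X \<omega>))) \<and>
          ereal (1 / real CARD('n) * (lq_norm 2 (X \<omega> *v (\<theta>hat - \<theta>star)))\<^sup>2)
            \<le> min (sens_bound (\<nu>\<^sup>2) (kappa 1 s (X \<omega>)))
                  (ereal (2 * \<nu> * lq_norm 1 \<theta>star))))"
proof -
  interpret prob_space M by fact
  \<comment> \<open>Listing the six failure events lets one indexed union bound treat them
    all.\<close>
  define bad where "bad = [
    {\<omega> \<in> space M. (MAX j. \<bar>\<sigma>2hat \<omega> $ j - noise_var M \<Xi> $ j\<bar>) \<ge> b},
    {\<omega> \<in> space M. mat_max_norm (M1 (X \<omega>) (\<Xi> \<omega>)) \<ge> \<delta>1},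
    {\<omega> \<in> space M. lq_norm \<infinity> (M2 (X \<omega>) (\<xi> \<omega>)) \<ge> \<delta>2},
    {\<omega> \<in> space M. lq_norm \<infinity> (M3 (\<Xi> \<omega>) (\<xi> \<omega>)) \<ge> \<delta>3},
    {\<omega> \<in> space M. mat_max_norm (M4 (\<Xi> \<omega>)) \<ge> \<delta>4},
    {\<omega> \<in> space M. mat_max_norm (M5 (noise_var M \<Xi>) (\<Xi> \<omega>)) \<ge> \<delta>5}]"
  have bad6: "{..<6} = {0, 1, 2, 3, 4, 5::nat}"
    by auto
  have MAX_ge: "c \<le> (MAX j. f j) \<longleftrightarrow> (\<exists>j. c \<le> f j)" for c :: real and f :: "'p \<Rightarrow> real"
    by (simp add: Max_ge_iff)
  \<comment> \<open>Writing matrix products as finite sums of entries reduces measurability of the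
    error norms to that of the entries of X, \<Xi> and \<xi>.\<close>
  have mult_comp: "(transpose A ** B) $ i $ j = (\<Sum>k\<in>UNIV. A $ k $ i * B $ k $ j)"
    "(transpose A *v v) $ i = (\<Sum>k\<in>UNIV. A $ k $ i * v $ k)"
    for A B :: "real ^ 'p ^ 'n" and v :: "real ^ 'n" and i j
    by (simp_all add: matrix_matrix_mult_def matrix_vector_mult_def transpose_def)
  have diag_comp: "diag_mat v $ i $ j = (if i = j then v $ i else 0)" for v :: "real ^ 'p" and i j
    by (simp add: diag_mat_def)
  have X: "(\<lambda>\<omega>. X \<omega> $ i $ j) \<in> borel_measurable M" for i j
    by (intro borel_measurable_vec_nth assms(2))
  have \<Xi>: "(\<lambda>\<omega>. \<Xi> \<omega> $ i $ j) \<in> borel_measurable M" for i j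
    by (intro borel_measurable_vec_nth assms(3))
  have \<xi>: "(\<lambda>\<omega>. \<xi> \<omega> $ i) \<in> borel_measurable M" for i
    by (intro borel_measurable_vec_nth assms(4))
  have \<sigma>: "(\<lambda>\<omega>. \<sigma>2hat \<omega> $ i) \<in> borel_measurable M" for i
    by (intro borel_measurable_vec_nth assms(5))
  note [measurable] = X \<Xi> \<xi> \<sigma>
  have [measurable]: "(\<lambda>\<omega>. MAX j. \<bar>\<sigma>2hat \<omega> $ j - noise_var M \<Xi> $ j\<bar>) \<in> borel_measurable M"
    by (intro borel_measurable_Max) simp_all
  have [measurable]: "(\<lambda>\<omega>. mat_max_norm (M1 (X \<omega>) (\<Xi> \<omega>))) \<in> borel_measurable M"
    by (rule borel_measurable_mat_max_norm)
      (simp only: M1_def vector_scaleR_component mult_comp, measurable)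
  have [measurable]: "(\<lambda>\<omega>. lq_norm \<infinity> (M2 (X \<omega>) (\<xi> \<omega>))) \<in> borel_measurable M"
    by (rule borel_measurable_lq_norm_inf)
      (simp only: M2_def vector_scaleR_component mult_comp, measurable)
  have [measurable]: "(\<lambda>\<omega>. lq_norm \<infinity> (M3 (\<Xi> \<omega>) (\<xi> \<omega>))) \<in> borel_measurable M"
    by (rule borel_measurable_lq_norm_inf)
      (simp only: M3_def vector_scaleR_component mult_comp, measurable)
  have [measurable]: "(\<lambda>\<omega>. mat_max_norm (M4 (\<Xi> \<omega>))) \<in> borel_measurable M"
    by (rule borel_measurable_mat_max_norm)
      (simp only: M4_def vector_scaleR_component vector_minus_component diag_part_def diag_comp
        vec_lambda_beta mult_comp, measurable)
  have [measurable]: "(\<lambda>\<omega>. mat_max_norm (M5 (noise_var M \<Xi>) (\<Xi> \<omega>))) \<in> borel_measurable M"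
    by (rule borel_measurable_mat_max_norm)
      (simp only: M5_def vector_scaleR_component vector_minus_component diag_part_def diag_comp
        vec_lambda_beta mult_comp, measurable)
  \<comment> \<open>A measurable event is exhibited on which the conclusion holds, so measurability
    of the conclusion, which quantifies over all minimizers, is never at issue.\<close>
  define E where "E = space M - (\<Union>i\<in>{..<6}. bad ! i)"
  have events: "bad ! i \<in> events" if "i \<in> {..<6}" for i
    using that unfolding bad6 bad_def by auto
  have "prob (bad ! i) \<le> \<epsilon>" if "i \<in> {..<6}" for i
    using that assms(20-25) unfolding bad6 bad_def by auto
  then have "1 - 6 * \<epsilon> \<le> prob E"
    unfolding E_def using prob_compl_Union_ge[of "{..<6}" "\<lambda>i. bad ! i" \<epsilon>] events by simp
  moreover have "E \<in> events"
    unfolding E_def using events by auto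
  moreover have "feasible_set \<Theta> (y \<omega>) (Z \<omega>) (\<sigma>2hat \<omega>) \<mu> \<tau> \<noteq> {} \<and>
       (\<forall>\<theta>hat.
          is_arg_min (lq_norm 1)
            (\<lambda>\<theta>. \<theta> \<in> feasible_set \<Theta> (y \<omega>) (Z \<omega>) (\<sigma>2hat \<omega>) \<mu> \<tau>) \<theta>hat \<longrightarrow>
          (\<forall>q\<ge>1. ereal (lq_norm q (\<theta>hat - \<theta>star)) \<le> sens_bound \<nu> (kappa q s (X \<omega>))) \<and>
          (\<forall>k. ereal \<bar>\<theta>hat $ k - \<theta>star $ k\<bar> \<le> sens_bound \<nu> (kappa_star k s (X \<omega>))) \<and>
          ereal (1 / real CARD('n) * (lq_norm 2 (X \<omega> *v (\<theta>hat - \<theta>star)))\<^sup>2)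
            \<le> min (sens_bound (\<nu>\<^sup>2) (kappa 1 s (X \<omega>)))
                  (ereal (2 * \<nu> * lq_norm 1 \<theta>star)))" if "\<omega> \<in> E" for \<omega>
  proof -
    have \<omega>: "\<omega> \<in> space M" using that by (simp add: E_def)
    \<comment> \<open>Outside the bad events all six inequalities are strict; the deterministic
      bound needs only the weak versions, entry by entry.\<close>
    have good:
      "\<And>j. \<bar>\<sigma>2hat \<omega> $ j - noise_var M \<Xi> $ j\<bar> \<le> b"
      "\<And>i j. \<bar>M1 (X \<omega>) (\<Xi> \<omega>) $ i $ j\<bar> \<le> \<delta>1"
      "\<And>j. \<bar>M2 (X \<omega>) (\<xi> \<omega>) $ j\<bar> \<le> \<delta>2"
      "\<And>j. \<bar>M3 (\<Xi> \<omega>) (\<xi> \<omega>) $ j\<bar> \<le> \<delta>3"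
      "\<And>i j. \<bar>M4 (\<Xi> \<omega>) $ i $ j\<bar> \<le> \<delta>4"
      "\<And>i j. \<bar>M5 (noise_var M \<Xi>) (\<Xi> \<omega>) $ i $ j\<bar> \<le> \<delta>5"
      using that unfolding E_def bad6 bad_def le_mat_max_norm_iff le_lq_norm_inf_iff MAX_ge
      by (simp_all add: not_le less_imp_le)
    note bounds = estimation_bounds[OF assms(6,7)[OF \<omega>] assms(11,12) good assms(26-28)]
    from bounds(1) have "feasible_set \<Theta> (y \<omega>) (Z \<omega>) (\<sigma>2hat \<omega>) \<mu> \<tau> \<noteq> {}"
      by blast
    with bounds(2) show ?thesis
      by blast
  qed
  ultimately show ?thesis
    by blast
qed

end
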